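(* Let $S$ be a semigroup. The intersection ideal graph $\Gamma(S)$ is disconnected if and only if $S$ contains at least two minimal left ideals and every nontrivial left ideal of $S$ is minimal as well as maximal.
   Context: A left ideal of a semigroup $S$ is a non-empty subset $I\subseteq S$ with $SI\subseteq I$; it is nontrivial if $I\neq S$. The intersection of two left ideals is nontrivial if it is non-empty. Minimal and maximal left ideals are understood to be nontrivial: a nontrivial left ideal is minimal if it does not properly contain any left ideal of $S$, and maximal if it is not properly contained in any nontrivial left ideal of $S$. The intersection ideal graph $\Gamma(S)$ is the simple undirected graph whose vertices are the nontrivial left ideals of $S$, with two distinct vertices $I,J$ adjacent if and only if $I\cap J$ is nontrivial. A graph is disconnected if it has two vertices not joined by any path. *)

theory Defs
  imports "Graph_Theory.Graph_Theory"
begin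

text \<open>
  The semigroup \<open>S\<close> is the universe of a type of class \<^class>\<open>semigroup_mult\<close>;
  multiplication is not assumed commutative and no identity or zero is assumed.
\<close>

definition left_ideal :: "'a::semigroup_mult set \<Rightarrow> bool" where
  "left_ideal I \<longleftrightarrow> I \<noteq> {} \<and> (\<forall>s. \<forall>x\<in>I. s * x \<in> I)"

definition nontrivial_left_ideal :: "'a::semigroup_mult set \<Rightarrow> bool" where
  "nontrivial_left_ideal I \<longleftrightarrow> left_ideal I \<and> I \<noteq> UNIV"

definition minimal_left_ideal :: "'a::semigroup_mult set \<Rightarrow> bool" where
  "minimal_left_ideal I \<longleftrightarrow> nontrivial_left_ideal I \<and> \<not> (\<exists>J. left_ideal J \<and> J \<subset> I)"

definition maximal_left_ideal :: "'a::semigroup_mult set \<Rightarrow> bool" where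
  "maximal_left_ideal I \<longleftrightarrow> nontrivial_left_ideal I \<and> \<not> (\<exists>J. nontrivial_left_ideal J \<and> I \<subset> J)"

text \<open>
  A simple undirected graph is encoded, as usual in the graph library, as a symmetric loop-free
  digraph whose arcs are ordered pairs. For the intersection of two left ideals, being nontrivial
  means being non-empty.
\<close>

definition intersection_ideal_graph :: "'a::semigroup_mult set pair_pre_digraph" where
  "intersection_ideal_graph = \<lparr>
     pverts = {I. nontrivial_left_ideal I},
     parcs = {(I, J). nontrivial_left_ideal I \<and> nontrivial_left_ideal J \<and> I \<noteq> J \<and> I \<inter> J \<noteq> {}} \<rparr>"

lemma pair_bidirected_digraph_intersection_ideal_graph:
  "pair_bidirected_digraph intersection_ideal_graph"
  by unfold_locales (auto simp: intersection_ideal_graph_def symmetric_def sym_def)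

text \<open>
  The negation of the library's \<^const>\<open>connected\<close> is not used here, since it also holds of the
  graph without vertices.
\<close>

definition disconnected_graph :: "('a, 'b) pre_digraph \<Rightarrow> bool" where
  "disconnected_graph G \<longleftrightarrow>
     (\<exists>u\<in>verts G. \<exists>v\<in>verts G. u \<noteq> v \<and> \<not> (\<exists>p. pre_digraph.apath G u p v))"

end

theory Submission
  imports Defs
begin

text \<open>
  If \<open>I \<noteq> J\<close> lie in different components, then \<open>I\<close> and \<open>J\<close> are disjoint and \<open>I \<union> J = S\<close>, since
  otherwise \<open>I \<union> J\<close> is a common neighbour. Moreover \<open>I\<close> is minimal: a left ideal \<open>K \<subset> I\<close> would
  make \<open>K \<union> J\<close> a common neighbour. So is \<open>J\<close>, and a left ideal meeting both \<open>I\<close> and \<open>J\<close> contains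
  both, hence equals \<open>S\<close>; thus \<open>I\<close> and \<open>J\<close> are the only nontrivial left ideals. Conversely,
  distinct minimal left ideals are disjoint, so if every nontrivial left ideal is minimal then
  the graph has no edges.
\<close>

lemma left_ideal_Int:
  assumes "left_ideal I" "left_ideal J" "I \<inter> J \<noteq> {}"
  shows "left_ideal (I \<inter> J)"
  using assms unfolding left_ideal_def by blast

lemma left_ideal_Un:
  assumes "left_ideal I" "left_ideal J"
  shows "left_ideal (I \<union> J)"
  using assms unfolding left_ideal_def by blast

lemma left_ideal_not_empty: "left_ideal I \<Longrightarrow> I \<noteq> {}"
  by (simp add: left_ideal_def)

text \<open>The intersection is a left ideal inside \<open>I\<close>, so by minimality it is all of
  \<open>I\<close>.\<close>

lemma minimal_left_ideal_subset:
  assumes "minimal_left_ideal I" "left_ideal K" "I \<inter> K \<noteq> {}"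
  shows "I \<subseteq> K"
proof -
  have "left_ideal (I \<inter> K)"
    using assms by (auto simp: minimal_left_ideal_def nontrivial_left_ideal_def intro: left_ideal_Int)
  then show ?thesis
    using assms(1) unfolding minimal_left_ideal_def by blast
qed

interpretation intersection_graph: wf_digraph "with_proj intersection_ideal_graph"
proof -
  interpret pair_bidirected_digraph intersection_ideal_graph
    by (rule pair_bidirected_digraph_intersection_ideal_graph)
  show "wf_digraph (with_proj intersection_ideal_graph)"
    by unfold_locales
qed

lemma verts_intersection_graph:
  "verts (with_proj intersection_ideal_graph) = {I. nontrivial_left_ideal I}"
  by (simp add: intersection_ideal_graph_def)

text \<open>Trades paths for the reachability relation, which is transitive and has an induction
  rule.\<close>

lemma disconnected_intersection_graph_iff:
  "disconnected_graph (with_proj (intersection_ideal_graph :: 'a::semigroup_mult set pair_pre_digraph))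
    \<longleftrightarrow> (\<exists>I J :: 'a set. nontrivial_left_ideal I \<and> nontrivial_left_ideal J \<and> I \<noteq> J \<and>
          \<not> I \<rightarrow>\<^sup>*\<^bsub>with_proj intersection_ideal_graph\<^esub> J)"
  unfolding disconnected_graph_def intersection_graph.reachable_apath verts_intersection_graph
  by blast

lemma intersection_graph_adj_iff:
  "I \<rightarrow>\<^bsub>with_proj intersection_ideal_graph\<^esub> J
    \<longleftrightarrow> nontrivial_left_ideal I \<and> nontrivial_left_ideal J \<and> I \<noteq> J \<and> I \<inter> J \<noteq> {}"
  by (auto simp: arcs_ends_def arc_to_ends_def intersection_ideal_graph_def)

text \<open>Lets the two endpoints of an unreachable pair be exchanged, so that minimality has to be
  proved for the first one only.\<close>

lemma intersection_graph_reachable_sym: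
  assumes "I \<rightarrow>\<^sup>*\<^bsub>with_proj intersection_ideal_graph\<^esub> J"
  shows "J \<rightarrow>\<^sup>*\<^bsub>with_proj intersection_ideal_graph\<^esub> I"
proof (rule symmetric_reachable[OF _ assms])
  show "symmetric (with_proj intersection_ideal_graph)"
    unfolding symmetric_def sym_def intersection_graph_adj_iff by blast
qed

lemma reachable_intersecting:
  assumes "nontrivial_left_ideal I" "nontrivial_left_ideal J" "I \<inter> J \<noteq> {}"
  shows "I \<rightarrow>\<^sup>*\<^bsub>with_proj intersection_ideal_graph\<^esub> J"
proof (cases "I = J")
  case True
  with assms(1) show ?thesis
    using intersection_graph.reachable_refl verts_intersection_graph by blast
next
  case False
  with assms show ?thesis
    using intersection_graph.reachable_adjI intersection_graph_adj_iff by blast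
qed

text \<open>\<open>K\<close> may coincide with \<open>I\<close> or \<open>J\<close>, because
  \<open>reachable_intersecting\<close> also covers equal vertices. When a union is used as
  \<open>K\<close>, distinctness therefore need not be checked.\<close>

lemma reachable_common_neighbour:
  assumes "nontrivial_left_ideal I" "nontrivial_left_ideal J" "nontrivial_left_ideal K"
    and "I \<inter> K \<noteq> {}" "K \<inter> J \<noteq> {}"
  shows "I \<rightarrow>\<^sup>*\<^bsub>with_proj intersection_ideal_graph\<^esub> J"
  using assms intersection_graph.reachable_trans reachable_intersecting by metis

lemma not_reachable_imp_disjoint:
  assumes "nontrivial_left_ideal I" "nontrivial_left_ideal J"
    and "\<not> I \<rightarrow>\<^sup>*\<^bsub>with_proj intersection_ideal_graph\<^esub> J"
  shows "I \<inter> J = {}"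
  using assms reachable_intersecting by blast

lemma not_reachable_imp_minimal:
  assumes I: "nontrivial_left_ideal I" and J: "nontrivial_left_ideal J"
    and nr: "\<not> I \<rightarrow>\<^sup>*\<^bsub>with_proj intersection_ideal_graph\<^esub> J"
  shows "minimal_left_ideal I"
proof (rule ccontr)
  assume "\<not> minimal_left_ideal I"
  then obtain K where K: "left_ideal K" "K \<subset> I"
    using I by (auto simp: minimal_left_ideal_def)
  \<comment> \<open>A point of \<open>I - K\<close> lies outside \<open>K\<close>, and outside
    \<open>J\<close> because \<open>I\<close> and \<open>J\<close> are disjoint.\<close>
  have "K \<union> J \<noteq> UNIV"
    using K not_reachable_imp_disjoint[OF assms] by blast
  then have "nontrivial_left_ideal (K \<union> J)"
    using K J by (simp add: nontrivial_left_ideal_def left_ideal_Un)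
  moreover have "I \<inter> (K \<union> J) \<noteq> {}" "(K \<union> J) \<inter> J \<noteq> {}"
    using K J left_ideal_not_empty unfolding nontrivial_left_ideal_def by blast+
  ultimately show False
    using reachable_common_neighbour[OF I J] nr by blast
qed

lemma not_reachable_imp_cover:
  assumes I: "nontrivial_left_ideal I" and J: "nontrivial_left_ideal J"
    and nr: "\<not> I \<rightarrow>\<^sup>*\<^bsub>with_proj intersection_ideal_graph\<^esub> J"
  shows "I \<union> J = UNIV"
proof (rule ccontr)
  assume "I \<union> J \<noteq> UNIV"
  then have "nontrivial_left_ideal (I \<union> J)"
    using I J by (simp add: nontrivial_left_ideal_def left_ideal_Un)
  moreover have "I \<inter> (I \<union> J) \<noteq> {}" "(I \<union> J) \<inter> J \<noteq> {}"
    using I J left_ideal_not_empty unfolding nontrivial_left_ideal_def by blast+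
  ultimately show False
    using reachable_common_neighbour[OF I J] nr by blast
qed

lemma not_reachable_imp_exhaust:
  assumes I: "nontrivial_left_ideal I" and J: "nontrivial_left_ideal J"
    and nr: "\<not> I \<rightarrow>\<^sup>*\<^bsub>with_proj intersection_ideal_graph\<^esub> J"
    and K: "nontrivial_left_ideal K"
  shows "K = I \<or> K = J"
proof -
  have min: "minimal_left_ideal I" "minimal_left_ideal J"
    using not_reachable_imp_minimal[OF I J nr] not_reachable_imp_minimal[OF J I]
      intersection_graph_reachable_sym nr by blast+
  have cover: "I \<union> J = UNIV"
    by (rule not_reachable_imp_cover[OF I J nr])
  have K': "left_ideal K" "K \<noteq> UNIV"
    using K by (auto simp: nontrivial_left_ideal_def)
  have "\<not> (I \<subseteq> K \<and> J \<subseteq> K)"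
    using cover K' by blast
  then have "K \<inter> I = {} \<or> K \<inter> J = {}"
    using minimal_left_ideal_subset[OF min(1) K'(1)] minimal_left_ideal_subset[OF min(2) K'(1)] by blast
  \<comment> \<open>As \<open>I\<close> and \<open>J\<close> cover everything, a set disjoint from
    one lies in the other; minimality of the latter then excludes proper inclusion.\<close>
  then have "K \<subseteq> I \<or> K \<subseteq> J"
    using cover by blast
  then show ?thesis
    using min K'(1) unfolding minimal_left_ideal_def by blast
qed

text \<open>An arc would join distinct intersecting minimal left ideals, but these contain each
  other. Hence the induction step is contradictory, and only the walk of length zero
  remains.\<close>

lemma reachable_imp_eq_if_all_minimal:
  fixes I J :: "'a::semigroup_mult set"
  assumes min: "\<And>K :: 'a set. nontrivial_left_ideal K \<Longrightarrow> minimal_left_ideal K"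
    and "I \<rightarrow>\<^sup>*\<^bsub>with_proj intersection_ideal_graph\<^esub> J"
  shows "I = J"
  using assms(2)
proof (induction rule: intersection_graph.reachable_induct)
  case (step K L)
  then have "K \<noteq> L" "K \<inter> L \<noteq> {}" "nontrivial_left_ideal K" "nontrivial_left_ideal L"
    unfolding intersection_graph_adj_iff by blast+
  moreover from this have "K \<subseteq> L" "L \<subseteq> K"
    using min minimal_left_ideal_subset unfolding nontrivial_left_ideal_def by (metis Int_commute)+
  ultimately show ?case by blast
qed simp

theorem theorem3p1:
  shows "disconnected_graph (with_proj (intersection_ideal_graph :: 'a::semigroup_mult set pair_pre_digraph))
    \<longleftrightarrow> (\<exists>I J :: 'a set. minimal_left_ideal I \<and> minimal_left_ideal J \<and> I \<noteq> J) \<and>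
        (\<forall>I :: 'a set. nontrivial_left_ideal I \<longrightarrow> minimal_left_ideal I \<and> maximal_left_ideal I)"
    (is "?disconnected \<longleftrightarrow> ?two_minimal \<and> ?all_extremal")
proof
  assume ?disconnected
  then obtain I J :: "'a set" where I: "nontrivial_left_ideal I" and J: "nontrivial_left_ideal J"
    and "I \<noteq> J" and nr: "\<not> I \<rightarrow>\<^sup>*\<^bsub>with_proj intersection_ideal_graph\<^esub> J"
    unfolding disconnected_intersection_graph_iff by blast
  have min: "minimal_left_ideal I" "minimal_left_ideal J"
    using not_reachable_imp_minimal[OF I J nr] not_reachable_imp_minimal[OF J I]
      intersection_graph_reachable_sym nr by blast+
  have all_min: "minimal_left_ideal K" if "nontrivial_left_ideal K" for K :: "'a set"
    using not_reachable_imp_exhaust[OF I J nr that] min by blast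
  \<comment> \<open>A nontrivial left ideal properly containing \<open>K\<close> would itself be
    minimal, which \<open>K\<close> contradicts.\<close>
  then have "maximal_left_ideal K" if "nontrivial_left_ideal K" for K :: "'a set"
    using that unfolding maximal_left_ideal_def minimal_left_ideal_def nontrivial_left_ideal_def
    by blast
  with all_min min \<open>I \<noteq> J\<close> show "?two_minimal \<and> ?all_extremal"
    by blast
next
  assume "?two_minimal \<and> ?all_extremal"
  \<comment> \<open>The two distinct minimal left ideals are the unreachable pair: reachability
    would make them equal.\<close>
  then show ?disconnected
    unfolding disconnected_intersection_graph_iff
    using reachable_imp_eq_if_all_minimal minimal_left_ideal_def by metis
qed

end
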